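(* Let $X$ be a Banach space, let $T, C$ be bounded linear operators on $X$, and let $C$ be invertible. If $T$ is norm-unimodal, then $C^{-1}TC$ is also norm-unimodal.
   Context: A bounded linear operator $T$ on a Banach space $X$ is called norm-unimodal if there is a constant $r>1$ such that for every $m\in\mathbb{N}$ there exists a nonzero vector $x_m\in X$ satisfying $\lim_{k\to\infty}\|T^k x_m\|=0$ and $\|T^i x_m\|\ge r^i\|x_m\|$ for $i=1,2,\ldots,m$. *)

theory Defs
  imports "HOL-Analysis.Analysis"
begin

text \<open>
  Norm-unimodality and invertibility do not depend on the scalar field: a complex Banach space is in
  particular a real one, its complex-linear bounded operators are bounded real-linear ones, and
  inverses, norms and powers are unaffected. Hence the type class \<^class>\<open>banach\<close>,
  with bounded operators of type \<open>'a \<Rightarrow>\<^sub>L 'a\<close>, covers both cases.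
\<close>

definition norm_unimodal :: "('a::banach \<Rightarrow>\<^sub>L 'a) \<Rightarrow> bool" where
  "norm_unimodal T \<longleftrightarrow>
     (\<exists>r::real. r > 1 \<and>
       (\<forall>m::nat. \<exists>x. x \<noteq> 0 \<and>
         (\<lambda>k. norm ((blinfun_apply T ^^ k) x)) \<longlonglongrightarrow> 0 \<and>
         (\<forall>i\<in>{1..m}. norm ((blinfun_apply T ^^ i) x) \<ge> r ^ i * norm x)))"

definition is_blinfun_inverse ::
    "('a::real_normed_vector \<Rightarrow>\<^sub>L 'a) \<Rightarrow> ('a \<Rightarrow>\<^sub>L 'a) \<Rightarrow> bool" where
  "is_blinfun_inverse C D \<longleftrightarrow> C o\<^sub>L D = id_blinfun \<and> D o\<^sub>L C = id_blinfun"

definition blinfun_invertible :: "('a::real_normed_vector \<Rightarrow>\<^sub>L 'a) \<Rightarrow> bool" where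
  "blinfun_invertible C \<longleftrightarrow> (\<exists>D. is_blinfun_inverse C D)"

text \<open>Two-sided inverses are unique, so this is the inverse whenever the operator is invertible;
  otherwise the value is unspecified.\<close>

definition blinfun_inv :: "('a::real_normed_vector \<Rightarrow>\<^sub>L 'a) \<Rightarrow> ('a \<Rightarrow>\<^sub>L 'a)" where
  "blinfun_inv C = (THE D. is_blinfun_inverse C D)"

end

theory Submission
  imports Defs
begin

text \<open>
  Transporting the vectors \<open>x\<close> by \<open>C\<inverse>\<close> preserves the growth condition only up to the
  constant \<open>K = \<parallel>C\<parallel> \<parallel>C\<inverse>\<parallel>\<close>. The constant is removed by lowering the rate to some
  \<open>1 < s < r\<close> and replacing \<open>x\<close> by the orbit point \<open>S\<^sup>p x\<close> at which \<open>\<parallel>S\<^sup>p x\<parallel> / s\<^sup>p\<close> is minimal: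
  the minimum is attained early, namely before \<open>(r / s)\<^sup>p\<close> exceeds \<open>K\<close>, and from there on the
  orbit grows at rate \<open>s\<close> without a constant.
\<close>

lemma minimal_rate_index:
  fixes a :: "nat \<Rightarrow> real"
  assumes s: "0 < s" and a0: "0 < a 0" and K: "0 < K" and KN: "K < (r / s) ^ N" and sr: "s < r"
    and growth: "\<And>i. i \<in> {1..N + m} \<Longrightarrow> r ^ i * a 0 \<le> K * a i"
  obtains p where "0 < a p" "\<And>i. i \<le> m \<Longrightarrow> s ^ i * a p \<le> a (p + i)"
proof -
  define b where "b j = a j / s ^ j" for j
  obtain p where p: "p \<le> N + m" and min: "\<And>j. j \<le> N + m \<Longrightarrow> b p \<le> b j"
    using ex_min_if_finite[of "b ` {..N + m}"] by (fastforce simp: not_less)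
  \<comment> \<open>For \<open>p > N\<close> the growth bound gives
    \<open>b p \<ge> (r / s) ^ p * a 0 / K > a 0 = b 0\<close>, against minimality.\<close>
  have "p \<le> N"
  proof (rule ccontr)
    assume "\<not> p \<le> N"
    then have "N \<le> p" "p \<in> {1..N + m}" using p by auto
    have "1 \<le> r / s" using s sr by simp
    then have "K < (r / s) ^ p"
      using KN power_increasing[OF \<open>N \<le> p\<close>, of "r / s"] by linarith
    then have "K * s ^ p < r ^ p"
      using s by (simp add: power_divide pos_less_divide_eq)
    then have "K * s ^ p * a 0 < K * a p"
      using a0 growth[OF \<open>p \<in> {1..N + m}\<close>] by (smt (verit) mult_strict_right_mono)
    then have "a 0 < b p"
      using s K by (simp add: b_def pos_less_divide_eq mult.assoc mult.commute)
    moreover have "b p \<le> a 0" using min[of 0] by (simp add: b_def)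
    ultimately show False by simp
  qed
  \<comment> \<open>The growth bound starts at index 1, so \<open>p = 0\<close> is covered by
    \<open>a 0 > 0\<close> instead.\<close>
  have "0 < a p"
  proof (cases "p = 0")
    case False
    then have "0 < K * a p"
      using growth[of p] p a0 s sr by (smt (verit) atLeastAtMost_iff less_one linorder_not_le
        mult_pos_pos zero_less_power)
    then show ?thesis using K by (simp add: zero_less_mult_iff)
  qed (use a0 in simp)
  \<comment> \<open>As \<open>p \<le> N\<close>, the index \<open>p + i\<close> stays in the window
    where \<open>b p\<close> is minimal; clear the denominators in
    \<open>b p \<le> b (p + i)\<close>.\<close>
  moreover have "s ^ i * a p \<le> a (p + i)" if "i \<le> m" for i
    using min[of "p + i"] \<open>p \<le> N\<close> that s
    by (simp add: b_def power_add field_simps)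
  ultimately show ?thesis using that by blast
qed

text \<open>A fixed factor \<open>K\<close>, the same for all \<open>m\<close>, is absorbed by a
  smaller rate, since \<open>(r / s) ^ N\<close> eventually exceeds it.\<close>

lemma norm_unimodalI_up_to_constant:
  fixes S :: "'a::banach \<Rightarrow>\<^sub>L 'a"
  assumes r: "1 < r" and K: "0 < K"
    and ex: "\<And>m. \<exists>x. x \<noteq> 0 \<and> (\<lambda>k. norm ((blinfun_apply S ^^ k) x)) \<longlonglongrightarrow> 0 \<and>
      (\<forall>i\<in>{1..m}. r ^ i * norm x \<le> K * norm ((blinfun_apply S ^^ i) x))"
  shows "norm_unimodal S"
proof -
  obtain s where s: "1 < s" "s < r" using dense[OF r] by blast
  obtain N where N: "K < (r / s) ^ N"
    using real_arch_pow[of "r / s" K] s by auto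
  have "\<exists>y. y \<noteq> 0 \<and> (\<lambda>k. norm ((blinfun_apply S ^^ k) y)) \<longlonglongrightarrow> 0 \<and>
      (\<forall>i\<in>{1..m}. s ^ i * norm y \<le> norm ((blinfun_apply S ^^ i) y))" for m
  proof -
    \<comment> \<open>Up to \<open>N\<close> steps may be spent on reaching the minimum; the other
      \<open>m\<close> remain for the new vector.\<close>
    obtain x where x: "x \<noteq> 0" "(\<lambda>k. norm ((blinfun_apply S ^^ k) x)) \<longlonglongrightarrow> 0"
      and growth: "\<And>i. i \<in> {1..N + m} \<Longrightarrow> r ^ i * norm x \<le> K * norm ((blinfun_apply S ^^ i) x)"
      using ex[of "N + m"] by blast
    define a where "a i = norm ((blinfun_apply S ^^ i) x)" for i
    have "0 < s" "0 < a 0" using s x(1) by (simp_all add: a_def)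
    then obtain p where p: "0 < a p" "\<And>i. i \<le> m \<Longrightarrow> s ^ i * a p \<le> a (p + i)"
    proof (rule minimal_rate_index[OF _ _ K N s(2)])
      show "r ^ i * a 0 \<le> K * a i" if "i \<in> {1..N + m}" for i
        using growth[OF that] by (simp add: a_def)
    qed blast
    define y where "y = (blinfun_apply S ^^ p) x"
    have shift: "norm ((blinfun_apply S ^^ i) y) = a (i + p)" for i
      by (simp add: a_def y_def funpow_add)
    have "(\<lambda>k. a (k + p)) \<longlonglongrightarrow> 0"
      using x(2) unfolding a_def by (rule LIMSEQ_ignore_initial_segment)
    moreover have "norm y = a p" by (simp add: a_def y_def)
    ultimately show ?thesis
      using p by (intro exI[of _ y]) (auto simp: shift add.commute)
  qed
  with s(1) show ?thesis unfolding norm_unimodal_def by blast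
qed

lemma is_blinfun_inverse_blinfun_inv:
  assumes "blinfun_invertible C"
  shows "is_blinfun_inverse C (blinfun_inv C)"
proof -
  obtain D where D: "is_blinfun_inverse C D"
    using assms unfolding blinfun_invertible_def by blast
  \<comment> \<open>\<open>E = E (C D) = (E C) D = D\<close>, so the definite description is well
    defined.\<close>
  have "E = D" if "is_blinfun_inverse C E" for E
    using D that unfolding is_blinfun_inverse_def
    by (metis blinfun_apply_blinfun_compose blinfun_apply_id_blinfun blinfun_eqI id_apply)
  with D show ?thesis
    unfolding blinfun_inv_def by (metis theI)
qed

theorem proposition2p1:
  fixes T C :: "'a::banach \<Rightarrow>\<^sub>L 'a"
  assumes "blinfun_invertible C"
    and "norm_unimodal T"
  shows "norm_unimodal (blinfun_inv C o\<^sub>L T o\<^sub>L C)"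
proof -
  define D where "D = blinfun_inv C"
  define S where "S = D o\<^sub>L T o\<^sub>L C"
  define K where "K = norm C * norm D"
  have "C o\<^sub>L D = id_blinfun"
    using is_blinfun_inverse_blinfun_inv[OF assms(1)]
    unfolding is_blinfun_inverse_def D_def by auto
  then have CD: "C (D v) = v" for v
    by (metis blinfun_apply_blinfun_compose blinfun_apply_id_blinfun id_apply)
  obtain r where r: "1 < r" and ex: "\<And>m. \<exists>x. x \<noteq> 0 \<and>
      (\<lambda>k. norm ((blinfun_apply T ^^ k) x)) \<longlonglongrightarrow> 0 \<and>
      (\<forall>i\<in>{1..m}. r ^ i * norm x \<le> norm ((blinfun_apply T ^^ i) x))"
    using assms(2) unfolding norm_unimodal_def by blast
  \<comment> \<open>Each inner \<open>C D\<close> cancels, so \<open>D\<close> carries orbits of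
    \<open>T\<close> to orbits of \<open>S\<close>.\<close>
  have conj: "(blinfun_apply S ^^ k) (D x) = D ((blinfun_apply T ^^ k) x)" for k x
    by (induction k) (simp_all add: S_def CD)
  \<comment> \<open>A nonzero vector rules out the trivial space, where \<open>K\<close> would
    vanish.\<close>
  obtain v :: 'a where "v \<noteq> 0" using ex by blast
  then have "C \<noteq> 0" "D \<noteq> 0" using CD[of v] by auto
  then have "0 < K" by (simp add: K_def)
  have "norm_unimodal S"
  proof (rule norm_unimodalI_up_to_constant[OF r \<open>0 < K\<close>])
    fix m
    obtain x where x: "x \<noteq> 0" "(\<lambda>k. norm ((blinfun_apply T ^^ k) x)) \<longlonglongrightarrow> 0"
      and growth: "\<And>i. i \<in> {1..m} \<Longrightarrow> r ^ i * norm x \<le> norm ((blinfun_apply T ^^ i) x)"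
      using ex[of m] by blast
    have "D x \<noteq> 0" using x(1) CD[of x] by auto
    moreover have "(\<lambda>k. norm (D ((blinfun_apply T ^^ k) x))) \<longlonglongrightarrow> 0"
      using blinfun.tendsto[OF tendsto_const tendsto_norm_zero_cancel[OF x(2)], of D]
      by (simp add: tendsto_norm_zero)
    moreover have "r ^ i * norm (D x) \<le> K * norm (D ((blinfun_apply T ^^ i) x))"
      if "i \<in> {1..m}" for i
    proof -
      \<comment> \<open>\<open>K\<close> arises in two halves: \<open>norm D\<close> from bounding
        \<open>D x\<close> by \<open>x\<close>, and \<open>norm C\<close> from writing the
        \<open>T\<close>-orbit as \<open>C\<close> applied to the \<open>S\<close>-orbit.\<close>
      have "r ^ i * norm (D x) \<le> norm D * (r ^ i * norm x)"
        using mult_left_mono[OF norm_blinfun[of D x], of "r ^ i"] r by (simp add: mult.left_commute)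
      also have "\<dots> \<le> norm D * norm (C (D ((blinfun_apply T ^^ i) x)))"
        using growth[OF that] by (simp add: CD mult_left_mono)
      also have "\<dots> \<le> norm D * (norm C * norm (D ((blinfun_apply T ^^ i) x)))"
        by (intro mult_left_mono norm_blinfun norm_ge_zero)
      finally show ?thesis by (simp add: K_def mult_ac)
    qed
    ultimately show "\<exists>y. y \<noteq> 0 \<and> (\<lambda>k. norm ((blinfun_apply S ^^ k) y)) \<longlonglongrightarrow> 0 \<and>
        (\<forall>i\<in>{1..m}. r ^ i * norm y \<le> K * norm ((blinfun_apply S ^^ i) y))"
      by (intro exI[of _ "D x"]) (simp add: conj)
  qed
  then show ?thesis by (simp add: S_def D_def)
qed

end
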